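(* Let $a\in\mathbb{R}$, $\mu_1,\mu_2\in\mathbb{R}$, $\sigma_1,\sigma_2>0$, and let $p(t;x,z)$ be the transition density of the unique strong solution $X$ of $$\mathrm{d} X_t=(\mu_1 \mathbf{1}_{\{X_t \le a\}}+\mu_2 \mathbf{1}_{\{X_t> a\}})\,\mathrm{d} t+(\sigma_1\mathbf{1}_{\{X_t\le a\}}+\sigma_2\mathbf{1}_{\{X_t> a\}})\,\mathrm{d} B_t .$$ Let $t>0$ and $x\in\mathbb{R}$. Then $z\mapsto p(t;x,z)$ is continuous on $\mathbb{R}\setminus\{a\}$, and its one-sided limits at $z=a$ satisfy $$p(t;x,a+)-p(t;x,a-)=\begin{cases} 2\left(\frac{1}{\sigma_2^2}-\frac{1}{\sigma_1^2}\right) \displaystyle\int_0^{\infty}\!\! \int_0^{t} e^{\frac{2\mu_1b}{\sigma_1^2}} h\!\left(t-\tau ; \tfrac{b}{\sigma_1}, \tfrac{\mu_1}{\sigma_1}\right) h\!\left(\tau ;\tfrac{x-a+b}{\sigma_2},\tfrac{ \mu_2}{\sigma_2}\right) \mathrm{d} \tau\, \mathrm{d} b, & x\ge a,\\[2ex] 2\left(\frac{1}{\sigma_2^2}-\frac{1}{\sigma_1^2}\right) \displaystyle\int_{-\infty}^0\! \int_0^{t} e^{\frac{2\mu_2b}{\sigma_2^2}} h\!\left(t-\tau ; \tfrac{b}{\sigma_2}, \tfrac{\mu_2}{\sigma_2}\right) h\!\left(\tau ;\tfrac{x-a+b}{\sigma_1},\tfrac{ \mu_1}{\sigma_1}\right)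 \mathrm{d} \tau\, \mathrm{d} b, & x< a, \end{cases}$$ and, in both cases, this equals $$2\left(\frac{1}{\sigma_2^2}-\frac{1}{\sigma_1^2}\right) \int_{(a-x)^+}^{\infty} \int_0^{t} e^{\frac{2\mu_1b}{\sigma_1^2}} h\!\left(t-\tau ; \tfrac{b}{\sigma_1}, \tfrac{\mu_1}{\sigma_1}\right) h\!\left(\tau ;\tfrac{x-a+b}{\sigma_2},\tfrac{ \mu_2}{\sigma_2}\right) \mathrm{d} \tau\, \mathrm{d} b .$$ Furthermore, $z\mapsto p(t;x,z)$ is continuous on $\mathbb{R}$ if and only if $\sigma_1=\sigma_2$.
   Context: $B$ is a standard one-dimensional Brownian motion; the stochastic differential equation is known to have a unique strong solution. $y^+:=\max(y,0)$. The function $h$ is $h(t ; x, \mu):=\frac{|x|}{\sqrt{2 \pi t^3}} \exp [-\frac{(x+\mu t)^2}{2 t}]$ for $t>0$, $x,\mu\in\mathbb{R}$. The transition density $p(t;x,z)$ (density in $z$ of the law of $X_t$ given $X_0=x$) is understood as the following version. For $x\ge a$, $z\ge a$: $$\begin{aligned}p(t;x,z)=\;&\frac{2}{\sigma_2^2} \int_0^{\infty}\!\! \int_0^{t} e^{\frac{2\mu_2(z-a)}{\sigma_2^2}}e^{\frac{2\mu_1b}{\sigma_1^2}}\, h\!\left(t-\tau ; \tfrac{b}{\sigma_1}, \tfrac{\mu_1}{\sigma_1}\right) h\!\left(\tau ;\tfrac{z+x-2a+b}{\sigma_2},\tfrac{ \mu_2}{\sigma_2}\right) \mathrm{d} \tau\,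 \mathrm{d} b\\ &+\frac{1}{\sqrt{2 \pi t\sigma_2^2}} \left[\exp \left(-\frac{(z-x-\mu_2t)^2}{2 t\sigma_2^2}\right)-\exp \left(-\frac{(z+x-2a-\mu_2t)^2}{2t\sigma_2^2}-\frac{2 \mu_2(x-a)}{\sigma_2^2}\right)\right].\end{aligned}$$ For $x\ge a$, $z<a$: $$p(t;x,z)=\frac{2}{\sigma_1^2} \int_0^{\infty}\!\! \int_0^{t} e^{\frac{2\mu_1b}{\sigma_1^2}}\, h\!\left(t-\tau ; \tfrac{b-z+a}{\sigma_1}, \tfrac{\mu_1}{\sigma_1}\right) h\!\left(\tau ;\tfrac{x-a+b}{\sigma_2},\tfrac{ \mu_2}{\sigma_2}\right) \mathrm{d} \tau\, \mathrm{d} b.$$ For $x<a$, $z\le a$: $$\begin{aligned}p(t;x,z)=\;&\frac{2}{\sigma_1^2} \int_{-\infty}^{0}\! \int_0^{t} e^{\frac{2\mu_1(z-a)}{\sigma_1^2}} e^{\frac{2\mu_2b}{\sigma_2^2}}\, h\!\left(t-\tau ; \tfrac{b}{\sigma_2}, \tfrac{\mu_2}{\sigma_2}\right) h\!\left(\tau ;\tfrac{z+x-2a+b}{\sigma_1},\tfrac{ \mu_1}{\sigma_1}\right) \mathrm{d} \tau\, \mathrm{d} b\\ &+\frac{1}{\sqrt{2 \pi t\sigma_1^2}} \left[\exp \left(-\frac{(z-x-\mu_1t)^2}{2 t\sigma_1^2}\right)-\exp \left(-\frac{(z+x-2a-\mu_1t)^2}{2t\sigma_1^2}-\frac{2 \mu_1(x-a)}{\sigma_1^2}\right)\right].\end{aligned}$$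 For $x<a$, $z>a$: $$p(t;x,z)=\frac{2}{\sigma_2^2} \int_{-\infty}^{0}\! \int_0^{t} e^{\frac{2\mu_2b}{\sigma_2^2}}\, h\!\left(t-\tau ; \tfrac{b-z+a}{\sigma_2}, \tfrac{\mu_2}{\sigma_2}\right) h\!\left(\tau ;\tfrac{x-a+b}{\sigma_1},\tfrac{ \mu_1}{\sigma_1}\right) \mathrm{d} \tau\, \mathrm{d} b.$$ *)

theory Defs
  imports "HOL-Probability.Probability"
begin

text \<open>Processes have type \<open>real \<Rightarrow> 'w \<Rightarrow> real\<close>; only times \<open>t \<ge> 0\<close> are meaningful.\<close>

definition brownian_motion :: "'w measure \<Rightarrow> (real \<Rightarrow> 'w \<Rightarrow> real) \<Rightarrow> bool" where
  "brownian_motion M B \<longleftrightarrow>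
     prob_space M \<and>
     (\<forall>t\<ge>0. B t \<in> borel_measurable M) \<and>
     (AE w in M. B 0 w = 0) \<and>
     (\<forall>s t. 0 \<le> s \<longrightarrow> s < t \<longrightarrow>
        distributed M lborel (\<lambda>w. B t w - B s w)
          (\<lambda>y. ennreal (normal_density 0 (sqrt (t - s)) y))) \<and>
     (\<forall>(n::nat) (ts::nat \<Rightarrow> real). 0 \<le> ts 0 \<longrightarrow> (\<forall>i<n. ts i \<le> ts (Suc i)) \<longrightarrow>
        prob_space.indep_vars M (\<lambda>_. borel) (\<lambda>i w. B (ts (Suc i)) w - B (ts i) w) {..<n}) \<and>
     (AE w in M. continuous_on {0..} (\<lambda>t. B t w))"

text \<open>The filtration generated by \<open>B\<close>, augmented by the null sets of \<open>M\<close>. Adaptedness to it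
  is what makes a solution of an SDE a strong one.\<close>

definition augmented_filtration ::
    "'w measure \<Rightarrow> (real \<Rightarrow> 'w \<Rightarrow> real) \<Rightarrow> real \<Rightarrow> 'w measure" where
  "augmented_filtration M B t =
     sigma (space M)
       ({B s -` A \<inter> space M | s A. 0 \<le> s \<and> s \<le> t \<and> A \<in> sets (borel :: real measure)}
          \<union> null_sets M)"

text \<open>A simple process \<open>\<Sum>i<n. \<xi>\<^sub>i 1\<^bsub>(t\<^sub>i, t\<^sub>i\<^sub>+\<^sub>1]\<^esub>\<close> is given by the data \<open>n\<close>, \<open>ts\<close>, \<open>\<xi>\<close>.\<close>

definition simple_process ::
    "(real \<Rightarrow> 'w measure) \<Rightarrow> nat \<Rightarrow> (nat \<Rightarrow> real) \<Rightarrow> (nat \<Rightarrow> 'w \<Rightarrow> real) \<Rightarrow> bool" where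
  "simple_process F n ts \<xi> \<longleftrightarrow>
     0 \<le> ts 0 \<and>
     (\<forall>i<n. ts i \<le> ts (Suc i) \<and> \<xi> i \<in> borel_measurable (F (ts i)) \<and>
        (\<exists>C. \<forall>w\<in>space (F (ts i)). \<bar>\<xi> i w\<bar> \<le> C))"

definition simple_process_val ::
    "nat \<Rightarrow> (nat \<Rightarrow> real) \<Rightarrow> (nat \<Rightarrow> 'w \<Rightarrow> real) \<Rightarrow> real \<Rightarrow> 'w \<Rightarrow> real" where
  "simple_process_val n ts \<xi> t w = (\<Sum>i<n. \<xi> i w * indicator {ts i<..ts (Suc i)} t)"

definition simple_process_integral ::
    "(real \<Rightarrow> 'w \<Rightarrow> real) \<Rightarrow> nat \<Rightarrow> (nat \<Rightarrow> real) \<Rightarrow> (nat \<Rightarrow> 'w \<Rightarrow> real) \<Rightarrow> real \<Rightarrow> 'w \<Rightarrow> real" where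
  "simple_process_integral B n ts \<xi> t w =
     (\<Sum>i<n. \<xi> i w * (B (min (ts (Suc i)) t) w - B (min (ts i) t) w))"

text \<open>\<open>I t = \<integral>\<^sub>0\<^sup>t H s dB s\<close>: the square-integrable Ito integral, i.e. the mean-square limit of
  integrals of simple processes approximating \<open>H\<close> in mean square on every \<open>[0, T] \<times> \<Omega>\<close>. The
  localised extension is not needed, as the diffusion coefficient below is bounded.\<close>

definition has_ito_integral ::
    "'w measure \<Rightarrow> (real \<Rightarrow> 'w \<Rightarrow> real) \<Rightarrow> (real \<Rightarrow> 'w \<Rightarrow> real) \<Rightarrow> (real \<Rightarrow> 'w \<Rightarrow> real) \<Rightarrow> bool" where
  "has_ito_integral M B H I \<longleftrightarrow>
     (\<lambda>(s, w). H s w) \<in> borel_measurable (restrict_space borel {0..} \<Otimes>\<^sub>M M) \<and>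
     (\<forall>t\<ge>0. I t \<in> borel_measurable M) \<and>
     (\<exists>n ts \<xi>.
        (\<forall>k::nat. simple_process (augmented_filtration M B) (n k) (ts k) (\<xi> k)) \<and>
        (\<forall>T\<ge>0.
           (\<lambda>k. \<integral>\<^sup>+ (s, w). ennreal ((simple_process_val (n k) (ts k) (\<xi> k) s w - H s w)\<^sup>2)
                    * indicator {0..T} s \<partial>(lborel \<Otimes>\<^sub>M M)) \<longlonglongrightarrow> 0) \<and>
        (\<forall>T\<ge>0.
           (\<lambda>k. \<integral>\<^sup>+ w. ennreal ((simple_process_integral B (n k) (ts k) (\<xi> k) T w - I T w)\<^sup>2) \<partial>M)
              \<longlonglongrightarrow> 0))"

text \<open>Strong solution of \<open>dX = drift(X) dt + diff(X) dB\<close>, \<open>X 0 = x\<close>, driven by the given \<open>B\<close>.\<close>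

definition sde_strong_solution ::
    "'w measure \<Rightarrow> (real \<Rightarrow> 'w \<Rightarrow> real) \<Rightarrow> (real \<Rightarrow> real) \<Rightarrow> (real \<Rightarrow> real) \<Rightarrow> real
       \<Rightarrow> (real \<Rightarrow> 'w \<Rightarrow> real) \<Rightarrow> bool" where
  "sde_strong_solution M B drift diff x X \<longleftrightarrow>
     (\<forall>t\<ge>0. X t \<in> borel_measurable (augmented_filtration M B t)) \<and>
     (AE w in M. continuous_on {0..} (\<lambda>t. X t w)) \<and>
     (AE w in M. X 0 w = x) \<and>
     (\<exists>I. has_ito_integral M B (\<lambda>s w. diff (X s w)) I \<and>
        (\<forall>t\<ge>0. AE w in M. X t w = x + (LBINT s:{0..t}. drift (X s w)) + I t w))"

definition two_valued :: "real \<Rightarrow> real \<Rightarrow> real \<Rightarrow> real \<Rightarrow> real" where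
  "two_valued a c\<^sub>1 c\<^sub>2 y = c\<^sub>1 * indicator {..a} y + c\<^sub>2 * indicator {a<..} y"

definition hker :: "real \<Rightarrow> real \<Rightarrow> real \<Rightarrow> real" where
  "hker t x \<mu> = \<bar>x\<bar> / sqrt (2 * pi * t ^ 3) * exp (- ((x + \<mu> * t)\<^sup>2 / (2 * t)))"

text \<open>The version of the transition density, defined for \<open>t > 0\<close> and every \<open>x\<close>, \<open>z\<close>.\<close>

definition density_version ::
    "real \<Rightarrow> real \<Rightarrow> real \<Rightarrow> real \<Rightarrow> real \<Rightarrow> real \<Rightarrow> real \<Rightarrow> real \<Rightarrow> real" where
  "density_version a \<mu>\<^sub>1 \<mu>\<^sub>2 \<sigma>\<^sub>1 \<sigma>\<^sub>2 t x z =
    (if x \<ge> a then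
       (if z \<ge> a then
          2 / \<sigma>\<^sub>2\<^sup>2 * (LBINT b:{0<..}. LBINT \<tau>:{0<..<t}.
             exp (2 * \<mu>\<^sub>2 * (z - a) / \<sigma>\<^sub>2\<^sup>2) * exp (2 * \<mu>\<^sub>1 * b / \<sigma>\<^sub>1\<^sup>2)
             * hker (t - \<tau>) (b / \<sigma>\<^sub>1) (\<mu>\<^sub>1 / \<sigma>\<^sub>1)
             * hker \<tau> ((z + x - 2 * a + b) / \<sigma>\<^sub>2) (\<mu>\<^sub>2 / \<sigma>\<^sub>2))
          + 1 / sqrt (2 * pi * t * \<sigma>\<^sub>2\<^sup>2) *
             (exp (- ((z - x - \<mu>\<^sub>2 * t)\<^sup>2 / (2 * t * \<sigma>\<^sub>2\<^sup>2)))
              - exp (- ((z + x - 2 * a - \<mu>\<^sub>2 * t)\<^sup>2 / (2 * t * \<sigma>\<^sub>2\<^sup>2)) - 2 * \<mu>\<^sub>2 * (x - a) / \<sigma>\<^sub>2\<^sup>2))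
        else
          2 / \<sigma>\<^sub>1\<^sup>2 * (LBINT b:{0<..}. LBINT \<tau>:{0<..<t}.
             exp (2 * \<mu>\<^sub>1 * b / \<sigma>\<^sub>1\<^sup>2)
             * hker (t - \<tau>) ((b - z + a) / \<sigma>\<^sub>1) (\<mu>\<^sub>1 / \<sigma>\<^sub>1)
             * hker \<tau> ((x - a + b) / \<sigma>\<^sub>2) (\<mu>\<^sub>2 / \<sigma>\<^sub>2)))
     else
       (if z \<le> a then
          2 / \<sigma>\<^sub>1\<^sup>2 * (LBINT b:{..<0}. LBINT \<tau>:{0<..<t}.
             exp (2 * \<mu>\<^sub>1 * (z - a) / \<sigma>\<^sub>1\<^sup>2) * exp (2 * \<mu>\<^sub>2 * b / \<sigma>\<^sub>2\<^sup>2)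
             * hker (t - \<tau>) (b / \<sigma>\<^sub>2) (\<mu>\<^sub>2 / \<sigma>\<^sub>2)
             * hker \<tau> ((z + x - 2 * a + b) / \<sigma>\<^sub>1) (\<mu>\<^sub>1 / \<sigma>\<^sub>1))
          + 1 / sqrt (2 * pi * t * \<sigma>\<^sub>1\<^sup>2) *
             (exp (- ((z - x - \<mu>\<^sub>1 * t)\<^sup>2 / (2 * t * \<sigma>\<^sub>1\<^sup>2)))
              - exp (- ((z + x - 2 * a - \<mu>\<^sub>1 * t)\<^sup>2 / (2 * t * \<sigma>\<^sub>1\<^sup>2)) - 2 * \<mu>\<^sub>1 * (x - a) / \<sigma>\<^sub>1\<^sup>2))
        else
          2 / \<sigma>\<^sub>2\<^sup>2 * (LBINT b:{..<0}. LBINT \<tau>:{0<..<t}.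
             exp (2 * \<mu>\<^sub>2 * b / \<sigma>\<^sub>2\<^sup>2)
             * hker (t - \<tau>) ((b - z + a) / \<sigma>\<^sub>2) (\<mu>\<^sub>2 / \<sigma>\<^sub>2)
             * hker \<tau> ((x - a + b) / \<sigma>\<^sub>1) (\<mu>\<^sub>1 / \<sigma>\<^sub>1))))"

end

theory Submission
  imports Defs
begin

text \<open>Every double integral in the density has the form
  \<open>K(u, v) = \<integral>\<^bsub>b>0\<^esub> \<integral>\<^bsub>0<\<tau><t\<^esub> exp(k b) h(t - \<tau>; (b + u)/r, m) h(\<tau>; (b + v)/s, n)\<close> with
  \<open>u, v \<ge> 0\<close>, the case \<open>x < a\<close> being the mirror image of \<open>x > a\<close>. The integrand is dominated,
  uniformly in \<open>u\<close> and \<open>v\<close>, by an integrable product of a function of \<open>b\<close> and a function of \<open>\<tau>\<close>,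
  so \<open>K\<close> is continuous up to the boundary. At \<open>z = a\<close> the Gaussian terms cancel and the one-sided
  limits are \<open>2 K / \<sigma>\<^sub>2\<^sup>2\<close> and \<open>2 K / \<sigma>\<^sub>1\<^sup>2\<close> with the same \<open>K > 0\<close>.\<close>

section \<open>Symmetries, regularity and pointwise bounds of the kernel \<open>hker\<close>\<close>

lemma hker_nonneg: "s > 0 \<Longrightarrow> 0 \<le> hker s y \<mu>"
  by (simp add: hker_def)

lemma hker_pos: "s > 0 \<Longrightarrow> y \<noteq> 0 \<Longrightarrow> 0 < hker s y \<mu>"
  by (simp add: hker_def)

lemma hker_uminus: "hker s (- y) (- \<mu>) = hker s y \<mu>"
  by (simp add: hker_def power2_eq_square algebra_simps)

text \<open>Completing the square: \<open>(y + \<mu> * s)\<^sup>2\<close> and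
  \<open>(y - \<mu> * s)\<^sup>2\<close> differ by \<open>4 * \<mu> * y * s\<close>, so an
  exponential weight is the same as a change of sign of the drift.\<close>

lemma exp_times_hker:
  assumes "s > 0"
  shows "exp (2 * \<mu> * y) * hker s y \<mu> = hker s y (- \<mu>)"
proof -
  have "2 * \<mu> * y + - ((y + \<mu> * s)\<^sup>2 / (2 * s)) = - ((y + - \<mu> * s)\<^sup>2 / (2 * s))"
    using assms by (simp add: field_simps power2_eq_square)
  then have "exp (2 * \<mu> * y) * exp (- ((y + \<mu> * s)\<^sup>2 / (2 * s)))
      = exp (- ((y + - \<mu> * s)\<^sup>2 / (2 * s)))"
    by (metis exp_add)
  then show ?thesis
    by (simp add: hker_def mult.left_commute)
qed

lemma hker_measurable [measurable]:
  assumes [measurable]: "f \<in> borel_measurable M" "g \<in> borel_measurable M"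
  shows "(\<lambda>w. hker (f w) (g w) \<mu>) \<in> borel_measurable M"
  unfolding hker_def by measurable

text \<open>Stated for every real \<open>s\<close>, because the dominated convergence argument below
  takes the limit of the integrand at every \<open>\<tau>\<close>, including those where
  \<open>\<tau>\<close> or \<open>t - \<tau>\<close> is zero or negative.\<close>

lemma continuous_hker: "continuous (at y) (\<lambda>y. hker s y \<mu>)"
proof (cases "s = 0")
  case False
  then show ?thesis unfolding hker_def by (auto intro!: continuous_intros)
\<comment> \<open>For \<open>s = 0\<close> the prefactor is a division by zero, so the kernel is
  constantly 0.\<close>
qed (simp add: hker_def)

text \<open>The factor \<open>s powr (-7/8)\<close> keeps the bound integrable at both ends in the time convolution
  of two kernels, while the product of the two factors \<open>y powr (-1/4)\<close> remains integrable in \<open>y\<close>.\<close>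

lemma hker_le:
  assumes "0 < s" "s \<le> t" "0 < y"
  shows "hker s y \<mu> \<le> 4 * exp (2 * t * \<mu>\<^sup>2) * y powr (- 1 / 4) * exp (- (y\<^sup>2 / (8 * t)))
      * s powr (- 7 / 8)"
proof -
  \<comment> \<open>The scale-invariant variable: \<open>y / s powr (3/2)\<close> equals
    \<open>r powr (5/8) * y powr (- 1 / 4) * s powr (- 7 / 8)\<close>, and the power of
    \<open>r\<close> is absorbed by a factor \<open>exp (- (r / 4))\<close> of the Gaussian.\<close>
  define r where "r = y\<^sup>2 / s"
  have r: "r > 0" using assms by (simp add: r_def)
  have "t > 0" using assms by simp
  have "r powr (5/8) \<le> 1 + r"
  proof (cases "r \<le> 1")
    case True
    then have "r powr (5/8) \<le> 1" using r by (simp add: powr_le1)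
    then show ?thesis using r by simp
  next
    case False
    then have "r powr (5/8) \<le> r powr 1" by (intro powr_mono) auto
    then show ?thesis using r by simp
  qed
  also have "\<dots> \<le> 4 * exp (r / 4)"
    using exp_ge_add_one_self[of "r / 4"] r by linarith
  finally have r58: "r powr (5/8) \<le> 4 * exp (r / 4)" .
  have sq: "sqrt (2 * pi * s ^ 3) \<ge> s powr (3 / 2)"
  proof -
    have "s powr (3/2) = sqrt (s ^ 3)"
      using assms by (simp add: powr_half_sqrt[symmetric] powr_powr powr_numeral[symmetric] del: powr_numeral)
    also have "\<dots> \<le> sqrt (2 * pi * s ^ 3)"
      using assms pi_gt3 by (intro real_sqrt_le_mono) (simp add: mult_le_cancel_right1)
    finally show ?thesis .
  qed
  \<comment> \<open>The term \<open>r / 2\<close> of the expanded exponent is split. One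
    \<open>r / 4\<close> is reserved for the power of \<open>r\<close>. The other is at least y^2 /
    (4 t), since \<open>s \<le> t\<close>; half of that is kept as decay in \<open>y\<close>, and
    the other half pays for the cross term \<open>y * \<mu>\<close> up to the constant
    \<open>2 * t * \<mu>\<^sup>2\<close>.\<close>
  have ex: "- ((y + \<mu> * s)\<^sup>2 / (2 * s)) \<le> - (r / 4) + - (y\<^sup>2 / (8 * t)) + 2 * t * \<mu>\<^sup>2"
  proof -
    have "(y + \<mu> * s)\<^sup>2 / (2 * s) = r / 2 + y * \<mu> + \<mu>\<^sup>2 * s / 2"
      using assms by (simp add: r_def field_simps power2_eq_square)
    moreover have "\<mu>\<^sup>2 * s / 2 \<ge> 0" using assms by simp
    moreover have "r / 4 \<ge> y\<^sup>2 / (4 * t)"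
      unfolding r_def using assms by (simp add: frac_le)
    moreover have "0 \<le> (y + 4 * t * \<mu>)\<^sup>2 / (8 * t)" using \<open>t > 0\<close> by simp
    then have "0 \<le> y\<^sup>2 / (8 * t) + y * \<mu> + 2 * t * \<mu>\<^sup>2"
      using \<open>t > 0\<close> by (simp add: field_simps power2_eq_square)
    moreover have "y\<^sup>2 / (4 * t) = y\<^sup>2 / (8 * t) + y\<^sup>2 / (8 * t)" by simp
    ultimately show ?thesis by linarith
  qed
  have "hker s y \<mu> \<le> y / s powr (3/2)
      * (exp (- (r / 4)) * exp (- (y\<^sup>2 / (8 * t))) * exp (2 * t * \<mu>\<^sup>2))"
    unfolding hker_def exp_add[symmetric] using assms sq ex
    by (intro mult_mono divide_left_mono) (auto intro!: divide_left_mono)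
  also have "y / s powr (3/2) = r powr (5/8) * (y powr (- 1 / 4) * s powr (- 7 / 8))"
  proof -
    have "r powr (5/8) = y powr (5/4) / s powr (5/8)"
      unfolding r_def using assms
      by (simp add: powr_divide powr_powr powr_numeral[symmetric] del: powr_numeral)
    moreover have "y powr (5/4) * y powr (- 1 / 4) = y"
      using assms by (simp add: powr_add[symmetric])
    moreover have "s powr (- 7 / 8) / s powr (5/8) = 1 / s powr (3/2)"
      using assms by (simp add: powr_diff[symmetric] powr_minus_divide[symmetric])
    moreover have "r powr (5/8) * (y powr (- 1 / 4) * s powr (- 7 / 8)) =
        (y powr (5/4) * y powr (- 1 / 4)) * (s powr (- 7 / 8) / s powr (5/8))"
      if "r powr (5/8) = y powr (5/4) / s powr (5/8)"
      using that by simp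
    ultimately show ?thesis by simp
  qed
  also have "r powr (5/8) * (y powr (- 1 / 4) * s powr (- 7 / 8)) \<le>
      4 * exp (r / 4) * (y powr (- 1 / 4) * s powr (- 7 / 8))"
    using r58 by (intro mult_right_mono) auto
  finally show ?thesis
    by (simp add: mult_ac exp_minus field_simps)
qed

text \<open>The bound of \<open>hker_le\<close> decreases in the space variable. This is what makes
  the domination below uniform in the shifts \<open>u\<close> and \<open>v\<close>.\<close>

lemma hker_shift_le:
  assumes "0 < s" "s \<le> t" "0 < y" "y \<le> y'"
  shows "hker s y' \<mu> \<le> 4 * exp (2 * t * \<mu>\<^sup>2) * y powr (- 1 / 4) * exp (- (y\<^sup>2 / (8 * t)))
      * s powr (- 7 / 8)"
proof -
  have "y' powr (- 1 / 4) \<le> y powr (- 1 / 4)"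
    using assms by (intro powr_mono2') auto
  moreover have "y\<^sup>2 / (8 * t) \<le> y'\<^sup>2 / (8 * t)"
    using assms by (intro divide_right_mono power_mono) auto
  ultimately have "4 * exp (2 * t * \<mu>\<^sup>2) * y' powr (- 1 / 4) * exp (- (y'\<^sup>2 / (8 * t)))
        * s powr (- 7 / 8)
      \<le> 4 * exp (2 * t * \<mu>\<^sup>2) * y powr (- 1 / 4) * exp (- (y\<^sup>2 / (8 * t))) * s powr (- 7 / 8)"
    by (intro mult_mono) auto
  with hker_le[of s t y' \<mu>] assms show ?thesis by linarith
qed

section \<open>The double integral: domination, integrability and continuity in the shifts\<close>

definition crossing_integrand ::
  "real \<Rightarrow> real \<Rightarrow> real \<Rightarrow> real \<Rightarrow> real \<Rightarrow> real \<Rightarrow> real \<Rightarrow> real \<Rightarrow> real \<Rightarrow> real \<Rightarrow> real" where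
  "crossing_integrand k m n r s t u v b \<tau> =
     exp (k * b) * hker (t - \<tau>) ((b + u) / r) m * hker \<tau> ((b + v) / s) n"

definition crossing_integral ::
  "real \<Rightarrow> real \<Rightarrow> real \<Rightarrow> real \<Rightarrow> real \<Rightarrow> real \<Rightarrow> real \<Rightarrow> real \<Rightarrow> real" where
  "crossing_integral k m n r s t u v =
     (LBINT b:{0<..}. LBINT \<tau>:{0<..<t}. crossing_integrand k m n r s t u v b \<tau>)"

lemma crossing_integrand_pos:
  assumes "r > 0" "s > 0" "b > 0" "0 < \<tau>" "\<tau> < t" "u \<ge> 0" "v \<ge> 0"
  shows "0 < crossing_integrand k m n r s t u v b \<tau>"
  using assms by (auto simp: crossing_integrand_def intro!: mult_pos_pos hker_pos)

lemma crossing_integrand_measurable [measurable]: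
  "(\<lambda>(b, \<tau>). crossing_integrand k m n r s t u v b \<tau>) \<in> borel_measurable (borel \<Otimes>\<^sub>M borel)"
  unfolding crossing_integrand_def by measurable

text \<open>The product of the two kernel bounds separates into a factor in \<open>b\<close> and a
  factor in \<open>\<tau>\<close>. The two powers of \<open>b\<close> combine to
  \<open>b powr (- 1 / 2)\<close> and a Gaussian beats \<open>exp (k * b)\<close>, which leaves the
  integrand of \<open>Gamma (1/2)\<close> in \<open>b\<close> and that of
  \<open>Beta (1/8) (1/8)\<close> in \<open>\<tau> / t\<close>.\<close>

lemma crossing_integrand_dominated:
  assumes "r > 0" "s > 0" "t > 0"
  obtains C where "C > 0"
    "\<And>u v b \<tau>. \<lbrakk>u \<ge> 0; v \<ge> 0; b > 0; 0 < \<tau>; \<tau> < t\<rbrakk> \<Longrightarrow> crossing_integrand k m n r s t u v b \<tau>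
       \<le> C * (b powr (- 1 / 2) / exp b) * ((\<tau> / t) powr (- 7 / 8) * (1 - \<tau> / t) powr (- 7 / 8))"
proof -
  \<comment> \<open>\<open>D\<close> collects the constants of the two kernel bounds, the scale
    factors from \<open>b / r\<close> and \<open>b / s\<close>, and the power of \<open>t\<close>
    from passing to \<open>\<tau> / t\<close>.\<close>
  define D where "D = 4 * exp (2 * t * m\<^sup>2) * (4 * exp (2 * t * n\<^sup>2)) * r powr (1/4) * s powr (1/4)
      * t powr (- 7 / 4)"
  \<comment> \<open>The exponent of \<open>E\<close> is the maximum over \<open>b\<close> of (k + 1)
    b - b^2 / (8 t r^2); taking \<open>k + 1\<close> in place of \<open>k\<close> leaves a spare
    factor \<open>1 / exp b\<close>.\<close>
  define E where "E = exp (2 * t * r\<^sup>2 * (k + 1)\<^sup>2)"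
  have "D > 0" "E > 0" using assms by (auto simp: D_def E_def)
  show ?thesis
  proof (rule that[of "D * E"])
    show "D * E > 0" using \<open>D > 0\<close> \<open>E > 0\<close> by simp
  next
    fix u v b \<tau> :: real
    assume *: "u \<ge> 0" "v \<ge> 0" "b > 0" "0 < \<tau>" "\<tau> < t"
    have h1: "hker (t - \<tau>) ((b + u) / r) m \<le> 4 * exp (2 * t * m\<^sup>2) * (b / r) powr (- 1 / 4)
        * exp (- ((b / r)\<^sup>2 / (8 * t))) * (t - \<tau>) powr (- 7 / 8)"
      using * assms by (intro hker_shift_le) (auto intro!: divide_right_mono)
    have h2: "hker \<tau> ((b + v) / s) n \<le> 4 * exp (2 * t * n\<^sup>2) * (b / s) powr (- 1 / 4)
        * exp (- ((b / s)\<^sup>2 / (8 * t))) * \<tau> powr (- 7 / 8)"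
      using * assms by (intro hker_shift_le) (auto intro!: divide_right_mono)
    \<comment> \<open>The decay in \<open>b\<close> is taken from the first kernel alone, so the
      Gaussian factor of the second is bounded by 1.\<close>
    have h3: "exp (- ((b / s)\<^sup>2 / (8 * t))) \<le> 1" using assms by simp
    have h2': "hker \<tau> ((b + v) / s) n \<le> 4 * exp (2 * t * n\<^sup>2) * (b / s) powr (- 1 / 4)
         * \<tau> powr (- 7 / 8)"
      using h3 by (intro order_trans[OF h2 mult_right_mono] mult_left_le) auto
    have h4: "exp (k * b) * exp (- ((b / r)\<^sup>2 / (8 * t))) \<le> E / exp b"
    proof -
      have "0 \<le> (b - 4 * t * r\<^sup>2 * (k + 1))\<^sup>2 / (8 * t * r\<^sup>2)" using assms by simp
      then have "k * b + - ((b / r)\<^sup>2 / (8 * t)) \<le> 2 * t * r\<^sup>2 * (k + 1)\<^sup>2 - b"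
        using assms by (simp add: field_simps power2_eq_square)
      then show ?thesis unfolding E_def exp_add[symmetric] exp_diff[symmetric] by simp
    qed
    have p: "(b / r) powr (- 1 / 4) * (b / s) powr (- 1 / 4)
        = r powr (1/4) * s powr (1/4) * b powr (- 1 / 2)"
    proof -
      have "(b / r) powr (- 1 / 4) * (b / s) powr (- 1 / 4)
        = b powr (- 1 / 4) * b powr (- 1 / 4) * (1 / r powr (- 1 / 4)) * (1 / s powr (- 1 / 4))"
        using assms * by (simp add: powr_divide)
      also have "b powr (- 1 / 4) * b powr (- 1 / 4) = b powr (- 1 / 2)"
        by (simp add: powr_add[symmetric])
      finally show ?thesis by (simp add: powr_minus_divide)
    qed
    have q: "(t - \<tau>) powr (- 7 / 8) * \<tau> powr (- 7 / 8)
        = t powr (- 7 / 4) * ((\<tau> / t) powr (- 7 / 8) * (1 - \<tau> / t) powr (- 7 / 8))"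
    proof -
      have "(\<tau> / t) powr (- 7 / 8) = \<tau> powr (- 7 / 8) / t powr (- 7 / 8)"
        using assms * by (simp add: powr_divide)
      moreover have "(1 - \<tau> / t) powr (- 7 / 8) = (t - \<tau>) powr (- 7 / 8) / t powr (- 7 / 8)"
        using assms * by (simp add: powr_divide[symmetric] diff_divide_distrib)
      moreover have "t powr (- 7 / 4) = t powr (- 7 / 8) * t powr (- 7 / 8)"
        by (simp add: powr_add[symmetric])
      ultimately show ?thesis using assms by simp
    qed
    have "crossing_integrand k m n r s t u v b \<tau> \<le> exp (k * b) *
        (4 * exp (2 * t * m\<^sup>2) * (b / r) powr (- 1 / 4)
          * exp (- ((b / r)\<^sup>2 / (8 * t))) * (t - \<tau>) powr (- 7 / 8)) *
        (4 * exp (2 * t * n\<^sup>2) * (b / s) powr (- 1 / 4) * \<tau> powr (- 7 / 8))"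
      unfolding crossing_integrand_def using h1 h2' * by (intro mult_mono) (auto intro!: hker_nonneg)
    also have "\<dots> = 4 * exp (2 * t * m\<^sup>2) * (4 * exp (2 * t * n\<^sup>2))
        * ((b / r) powr (- 1 / 4) * (b / s) powr (- 1 / 4))
        * ((t - \<tau>) powr (- 7 / 8) * \<tau> powr (- 7 / 8))
        * (exp (k * b) * exp (- ((b / r)\<^sup>2 / (8 * t))))"
      by (simp only: mult_ac)
    also have "\<dots> \<le> 4 * exp (2 * t * m\<^sup>2) * (4 * exp (2 * t * n\<^sup>2))
        * ((b / r) powr (- 1 / 4) * (b / s) powr (- 1 / 4))
        * ((t - \<tau>) powr (- 7 / 8) * \<tau> powr (- 7 / 8)) * (E / exp b)"
      by (intro mult_left_mono h4) auto
    also have "\<dots> = D * E * (b powr (- 1 / 2) / exp b)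
        * ((\<tau> / t) powr (- 7 / 8) * (1 - \<tau> / t) powr (- 7 / 8))"
      unfolding p q D_def by (simp add: mult_ac)
    finally show "crossing_integrand k m n r s t u v b \<tau> \<le> D * E * (b powr (- 1 / 2) / exp b)
        * ((\<tau> / t) powr (- 7 / 8) * (1 - \<tau> / t) powr (- 7 / 8))" .
  qed
qed

text \<open>This is the integrand of \<open>Gamma (1/2)\<close>. Nonnegativity upgrades its gauge
  integrability to absolute integrability, and Borel measurability carries that from Lebesgue
  measure to \<open>lborel\<close>.\<close>

lemma set_integrable_powr_div_exp:
  "set_integrable lborel {0<..} (\<lambda>b::real. b powr (- 1 / 2) / exp b)"
proof -
  have "(\<lambda>b::real. b powr (1 / 2 - 1) / exp b) integrable_on {0..}"
    using Gamma_integral_real[of "1/2"] by (auto simp: integrable_on_def)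
  then have "(\<lambda>b::real. b powr (- 1 / 2) / exp b) absolutely_integrable_on {0..}"
    by (intro nonnegative_absolutely_integrable_1) auto
  then have "set_integrable lebesgue {0<..} (\<lambda>b::real. b powr (- 1 / 2) / exp b)"
    by (rule set_integrable_subset) auto
  then show ?thesis
    unfolding set_integrable_def by (subst (asm) integrable_completion) auto
qed

text \<open>The integrand of \<open>Beta (1/8) (1/8)\<close> under the substitution of
  \<open>\<tau> / t\<close>.\<close>

lemma set_integrable_Beta_scaled:
  fixes t :: real
  assumes "t > 0"
  shows "set_integrable lborel {0<..<t} (\<lambda>\<tau>. (\<tau> / t) powr (- 7 / 8) * (1 - \<tau> / t) powr (- 7 / 8))"
proof -
  have "integrable lborel (\<lambda>x::real. indicator {0..1} x *\<^sub>R (x powr (1/8 - 1) * (1 - x) powr (1/8 - 1)))"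
    using integrable_Beta[of "1/8" "1/8"] unfolding set_integrable_def by simp
  from lborel_integrable_real_affine[OF this, of "1/t" 0] assms
  have "set_integrable lborel {0..t} (\<lambda>\<tau>. (\<tau> / t) powr (- 7 / 8) * (1 - \<tau> / t) powr (- 7 / 8))"
    unfolding set_integrable_def by (simp add: indicator_def zero_le_divide_iff)
  then show ?thesis by (rule set_integrable_subset) auto
qed

text \<open>The three conclusions are proved together because they share the dominating function
  \<open>A b * G \<tau>\<close>. Continuity comes from dominated convergence applied first to the
  inner integral at fixed \<open>b\<close>, then to the outer one. The closed quadrant matters: the
  limits at \<open>z = a\<close> are values with \<open>u = 0\<close>.\<close>

lemma
  assumes "r > 0" "s > 0" "t > 0"
  shows crossing_integrand_integrable: "\<And>u v b. \<lbrakk>u \<ge> 0; v \<ge> 0; b > 0\<rbrakk> \<Longrightarrow>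
      set_integrable lborel {0<..<t} (crossing_integrand k m n r s t u v b)"
    and crossing_integral_integrable: "\<And>u v. \<lbrakk>u \<ge> 0; v \<ge> 0\<rbrakk> \<Longrightarrow> set_integrable lborel {0<..}
      (\<lambda>b. LBINT \<tau>:{0<..<t}. crossing_integrand k m n r s t u v b \<tau>)"
    and continuous_on_crossing_integral:
      "continuous_on ({0..} \<times> {0..}) (\<lambda>(u, v). crossing_integral k m n r s t u v)"
proof -
  let ?F = "crossing_integrand k m n r s t"
  obtain C where C: "C > 0"
    "\<And>u v b \<tau>. \<lbrakk>u \<ge> 0; v \<ge> 0; b > 0; 0 < \<tau>; \<tau> < t\<rbrakk> \<Longrightarrow> ?F u v b \<tau>
       \<le> C * (b powr (- 1 / 2) / exp b) * ((\<tau> / t) powr (- 7 / 8) * (1 - \<tau> / t) powr (- 7 / 8))"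
    using crossing_integrand_dominated[OF assms] by metis
  define G :: "real \<Rightarrow> real" where "G \<tau> = (\<tau> / t) powr (- 7 / 8) * (1 - \<tau> / t) powr (- 7 / 8)" for \<tau>
  define A :: "real \<Rightarrow> real" where "A b = C * (b powr (- 1 / 2) / exp b)" for b
  have G: "set_integrable lborel {0<..<t} G"
    unfolding G_def by (rule set_integrable_Beta_scaled) fact
  have A: "set_integrable lborel {0<..} A"
    unfolding A_def by (intro set_integrable_mult_right set_integrable_powr_div_exp)
  have F: "\<bar>?F u v b \<tau>\<bar> \<le> A b * G \<tau>" if "u \<ge> 0" "v \<ge> 0" "b > 0" "0 < \<tau>" "\<tau> < t" for u v b \<tau>
    using C(2)[OF that] crossing_integrand_pos[OF assms(1,2) that(3-5) that(1,2), of k m n]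
    by (simp add: A_def G_def)
  have AG: "set_integrable lborel {0<..<t} (\<lambda>\<tau>. A b * G \<tau>)" for b
    using G by (rule set_integrable_mult_right)
  show I: "set_integrable lborel {0<..<t} (?F u v b)" if "u \<ge> 0" "v \<ge> 0" "b > 0" for u v b
    using F[OF that]
    by (intro set_integrable_bound[OF AG[of b]])
      (auto simp: set_borel_measurable_def intro!: AE_I2 intro: order_trans[OF _ abs_ge_self])
  define J where "J u v b = (LBINT \<tau>:{0<..<t}. ?F u v b \<tau>)" for u v b
  have J_meas [measurable]: "J u v \<in> borel_measurable borel" for u v
    unfolding J_def set_lebesgue_integral_def by measurable
  \<comment> \<open>Since the bound separates, the inner integral is dominated by \<open>A b\<close>
    times the total mass of \<open>G\<close>, again uniformly in \<open>u\<close> and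
    \<open>v\<close>.\<close>
  have J_le: "\<bar>J u v b\<bar> \<le> A b * (LBINT \<tau>:{0<..<t}. G \<tau>)" if "u \<ge> 0" "v \<ge> 0" "b > 0" for u v b
  proof -
    have "\<bar>J u v b\<bar> \<le> (LBINT \<tau>:{0<..<t}. \<bar>?F u v b \<tau>\<bar>)"
      unfolding J_def using set_integral_norm_bound[OF I[OF that]] by simp
    also have "\<dots> \<le> (LBINT \<tau>:{0<..<t}. A b * G \<tau>)"
      using F[OF that] by (intro set_integral_mono set_integrable_abs I that AG) auto
    finally show ?thesis by simp
  qed
  have AJ: "set_integrable lborel {0<..} (\<lambda>b. A b * (LBINT \<tau>:{0<..<t}. G \<tau>))"
    using A by (rule set_integrable_mult_left)
  show "set_integrable lborel {0<..} (\<lambda>b. LBINT \<tau>:{0<..<t}. ?F u v b \<tau>)" if "u \<ge> 0" "v \<ge> 0" for u v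
    unfolding J_def[symmetric]
    using J_le[OF that]
    by (intro set_integrable_bound[OF AJ])
      (auto simp: set_borel_measurable_def intro!: AE_I2 intro: order_trans[OF _ abs_ge_self])
  show "continuous_on ({0..} \<times> {0..}) (\<lambda>(u, v). crossing_integral k m n r s t u v)"
  proof (rule continuous_on_sequentiallyI, clarsimp)
    fix w :: "nat \<Rightarrow> real \<times> real" and u v
    assume w: "\<forall>i. w i \<in> {0..} \<times> {0..}" "w \<longlonglongrightarrow> (u, v)" and uv: "0 \<le> u" "0 \<le> v"
    define U where "U i = fst (w i)" for i
    define V where "V i = snd (w i)" for i
    have UV: "U i \<ge> 0" "V i \<ge> 0" for i
      using w(1) by (auto simp: U_def V_def mem_Times_iff)
    have lim: "U \<longlonglongrightarrow> u" "V \<longlonglongrightarrow> v"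
      using tendsto_fst[OF w(2)] tendsto_snd[OF w(2)] by (simp_all add: U_def[abs_def] V_def[abs_def])
    have J_lim: "(\<lambda>i. J (U i) (V i) b) \<longlonglongrightarrow> J u v b" if b: "b > 0" for b
      unfolding J_def set_lebesgue_integral_def
    proof (rule integral_dominated_convergence[where w = "\<lambda>\<tau>. indicator {0<..<t} \<tau> *\<^sub>R (A b * G \<tau>)"])
      show "integrable lborel (\<lambda>\<tau>. indicator {0<..<t} \<tau> *\<^sub>R (A b * G \<tau>))"
        using AG unfolding set_integrable_def .
      have "(\<lambda>i. ?F (U i) (V i) b \<tau>) \<longlonglongrightarrow> ?F u v b \<tau>" for \<tau>
        unfolding crossing_integrand_def
        using assms lim
        by (intro tendsto_intros isCont_tendsto_compose[OF continuous_hker]) auto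
      then show "AE \<tau> in lborel. (\<lambda>i. indicat_real {0<..<t} \<tau> *\<^sub>R ?F (U i) (V i) b \<tau>)
          \<longlonglongrightarrow> indicat_real {0<..<t} \<tau> *\<^sub>R ?F u v b \<tau>"
        by (intro AE_I2 tendsto_intros)
      show "AE \<tau> in lborel. norm (indicat_real {0<..<t} \<tau> *\<^sub>R ?F (U i) (V i) b \<tau>)
          \<le> indicator {0<..<t} \<tau> *\<^sub>R (A b * G \<tau>)" for i
        using F[OF UV b] by (intro AE_I2) (auto simp: indicator_def)
    qed measurable
    have "(\<lambda>i. crossing_integral k m n r s t (U i) (V i)) \<longlonglongrightarrow> crossing_integral k m n r s t u v"
      unfolding crossing_integral_def J_def[symmetric] unfolding set_lebesgue_integral_def
    proof (rule integral_dominated_convergence[where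
          w = "\<lambda>b. indicator {0<..} b *\<^sub>R (A b * (LBINT \<tau>:{0<..<t}. G \<tau>))"])
      show "integrable lborel (\<lambda>b. indicator {0<..} b *\<^sub>R (A b * (LBINT \<tau>:{0<..<t}. G \<tau>)))"
        using AJ unfolding set_integrable_def .
      show "AE b in lborel. (\<lambda>i. indicat_real {0<..} b *\<^sub>R J (U i) (V i) b)
          \<longlonglongrightarrow> indicat_real {0<..} b *\<^sub>R J u v b"
        using J_lim by (intro AE_I2) (auto simp: indicator_def)
      show "AE b in lborel. norm (indicat_real {0<..} b *\<^sub>R J (U i) (V i) b)
          \<le> indicator {0<..} b *\<^sub>R (A b * (LBINT \<tau>:{0<..<t}. G \<tau>))" for i
        using J_le[OF UV] by (intro AE_I2) (auto simp: indicator_def)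
    qed measurable
    then show "(\<lambda>i. case w i of (u, v) \<Rightarrow> crossing_integral k m n r s t u v)
        \<longlonglongrightarrow> crossing_integral k m n r s t u v"
      by (simp add: U_def V_def case_prod_unfold)
  qed
qed

section \<open>Strict positivity of the double integral\<close>

text \<open>If the integral were zero, strict positivity on \<open>S\<close> would make
  \<open>S\<close> a null set. It serves for the inner and the outer integral alike.\<close>

lemma set_integral_pos:
  fixes f :: "real \<Rightarrow> real"
  assumes "set_integrable lborel S f" "S \<in> sets lborel" "emeasure lborel S \<noteq> 0"
    and "\<And>x. x \<in> S \<Longrightarrow> 0 < f x"
  shows "0 < (LBINT x:S. f x)"
proof -
  let ?g = "\<lambda>x. indicator S x *\<^sub>R f x"
  have g: "integrable lborel ?g"
    using assms(1) unfolding set_integrable_def .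
  have nn: "0 \<le> integral\<^sup>L lborel ?g"
    using assms(4) by (intro integral_nonneg_AE AE_I2) (auto simp: indicator_def intro: less_imp_le)
  have "integral\<^sup>L lborel ?g \<noteq> 0"
  proof
    assume "integral\<^sup>L lborel ?g = 0"
    \<comment> \<open>The indicator is idempotent; the duplicate gives the integral over
      \<open>S\<close> the form that the null set criterion expects.\<close>
    also have "integral\<^sup>L lborel ?g = (LBINT x:S. ?g x)"
      unfolding set_lebesgue_integral_def by (intro Bochner_Integration.integral_cong) (auto simp: indicator_def)
    finally have "S \<in> null_sets lborel"
      using assms by (intro null_if_pos_func_has_zero_int[OF g]) auto
    with assms(3) show False by auto
  qed
  with nn show ?thesis unfolding set_lebesgue_integral_def by linarith
qed

text \<open>Positivity excludes a vanishing jump when the two diffusion coefficients differ.\<close>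

lemma crossing_integral_pos:
  assumes "r > 0" "s > 0" "t > 0" "u \<ge> 0" "v \<ge> 0"
  shows "0 < crossing_integral k m n r s t u v"
  unfolding crossing_integral_def
proof (rule set_integral_pos[OF crossing_integral_integrable])
  show "0 < (LBINT \<tau>:{0<..<t}. crossing_integrand k m n r s t u v b \<tau>)" if "b \<in> {0<..}" for b
    using that assms
    by (intro set_integral_pos crossing_integrand_integrable crossing_integrand_pos) auto
  have "emeasure lborel {0<..<1::real} \<le> emeasure lborel {0::real<..}"
    by (rule emeasure_mono) auto
  then show "emeasure lborel {0::real<..} \<noteq> 0" by auto
qed (use assms in auto)

section \<open>Gluing two continuous branches at a point\<close>

text \<open>Each branch is continuous up to \<open>a\<close>, so its value there is the one-sided
  limit. The disjunction \<open>fa\<close> leaves open which branch supplies \<open>f a\<close>; for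
  the density this depends on the side on which \<open>x\<close> lies.\<close>

lemma continuous_on_one_sided_glue:
  fixes f U L :: "real \<Rightarrow> real"
  assumes U: "continuous_on {a..} U" and L: "continuous_on {..a} L"
    and fU: "\<And>z. z > a \<Longrightarrow> f z = U z" and fL: "\<And>z. z < a \<Longrightarrow> f z = L z"
    and fa: "f a = U a \<or> f a = L a"
  shows "continuous_on (- {a}) f" "(f \<longlongrightarrow> U a) (at_right a)" "(f \<longlongrightarrow> L a) (at_left a)"
    "continuous_on UNIV f \<longleftrightarrow> U a = L a"
proof -
  have "continuous_on {a<..} f"
    by (rule continuous_on_eq[OF continuous_on_subset[OF U]]) (auto simp: fU)
  moreover have "continuous_on {..<a} f"
    by (rule continuous_on_eq[OF continuous_on_subset[OF L]]) (auto simp: fL)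
  moreover have "- {a} = {a<..} \<union> {..<a}" by auto
  ultimately show c: "continuous_on (- {a}) f"
    by (simp add: continuous_on_open_Un)
  have "(U \<longlongrightarrow> U a) (at a within {a..})"
    using U by (simp add: continuous_on_def)
  then have "(U \<longlongrightarrow> U a) (at_right a)"
    by (rule tendsto_within_subset) auto
  then show r: "(f \<longlongrightarrow> U a) (at_right a)"
    by (rule Lim_transform_eventually) (auto simp: fU eventually_at_filter)
  have "(L \<longlongrightarrow> L a) (at a within {..a})"
    using L by (simp add: continuous_on_def)
  then have "(L \<longlongrightarrow> L a) (at_left a)"
    by (rule tendsto_within_subset) auto
  then show l: "(f \<longlongrightarrow> L a) (at_left a)"
    by (rule Lim_transform_eventually) (auto simp: fL eventually_at_filter)
  show "continuous_on UNIV f \<longleftrightarrow> U a = L a"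
  proof
    assume "continuous_on UNIV f"
    then have "(f \<longlongrightarrow> f a) (at a)" by (simp add: continuous_on_def)
    then have "(f \<longlongrightarrow> f a) (at_right a)" "(f \<longlongrightarrow> f a) (at_left a)"
      by (simp_all add: filterlim_at_split)
    with r l show "U a = L a"
      by (metis tendsto_unique trivial_limit_at_right_real trivial_limit_at_left_real)
  next
    assume "U a = L a"
    with fa r l have "isCont f a"
      by (auto simp: isCont_def filterlim_at_split)
    moreover have "isCont f z" if "z \<noteq> a" for z
      using c that by (simp add: continuous_on_eq_continuous_at open_Compl)
    ultimately show "continuous_on UNIV f"
      by (metis continuous_at_imp_continuous_on)
  qed
qed

section \<open>Reflection and the two branches of the density; an identity between double
  integrals\<close>

text \<open>Reflecting the line exchanges the two half-lines: the diffusion coefficients swap, the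
  drifts swap and change sign. In the formulas this is the substitution of \<open>- b\<close> for
  \<open>b\<close> together with \<open>hker_uminus\<close>.\<close>

lemma density_version_reflect:
  assumes "x < a"
  shows "density_version a \<mu>\<^sub>1 \<mu>\<^sub>2 \<sigma>\<^sub>1 \<sigma>\<^sub>2 t x z
    = density_version (- a) (- \<mu>\<^sub>2) (- \<mu>\<^sub>1) \<sigma>\<^sub>2 \<sigma>\<^sub>1 t (- x) (- z)"
proof -
  have refl: "(LBINT b:{..<0}. f b) = (LBINT b:{0<..}. f (- b))" for f :: "real \<Rightarrow> real"
    by (subst set_integral_reflect) (simp add: greaterThan_def)
  have h1: "hker s (- b / \<sigma>) (\<mu> / \<sigma>) = hker s (b / \<sigma>) (- \<mu> / \<sigma>)" for s b \<sigma> \<mu>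
    using hker_uminus[of s "b / \<sigma>" "- \<mu> / \<sigma>"] by simp
  have h2: "hker s ((z + x - 2 * a + - b) / \<sigma>) (\<mu> / \<sigma>)
      = hker s ((- z + - x - 2 * - a + b) / \<sigma>) (- \<mu> / \<sigma>)" for s b \<sigma> \<mu>
    using h1[of s "- z + - x - 2 * - a + b" \<sigma> \<mu>] by (simp add: algebra_simps)
  have h3: "hker s ((- b - z + a) / \<sigma>) (\<mu> / \<sigma>)
      = hker s ((b - - z + - a) / \<sigma>) (- \<mu> / \<sigma>)" for s b \<sigma> \<mu>
    using h1[of s "b - - z + - a" \<sigma> \<mu>] by (simp add: algebra_simps)
  have h4: "hker s ((x - a + - b) / \<sigma>) (\<mu> / \<sigma>)
      = hker s ((- x - - a + b) / \<sigma>) (- \<mu> / \<sigma>)" for s b \<sigma> \<mu>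
    using h1[of s "- x - - a + b" \<sigma> \<mu>] by (simp add: algebra_simps)
  have e: "2 * \<mu> * - b / \<sigma>\<^sup>2 = 2 * - \<mu> * b / \<sigma>\<^sup>2" "2 * \<mu> * (b - c) / \<sigma>\<^sup>2 = 2 * - \<mu> * (- b - - c) / \<sigma>\<^sup>2"
    for \<mu> b c \<sigma> :: real
    by (simp_all add: algebra_simps)
  have g: "(z - x - \<mu>\<^sub>1 * t)\<^sup>2 = (- z - - x - - \<mu>\<^sub>1 * t)\<^sup>2"
    "(z + x - 2 * a - \<mu>\<^sub>1 * t)\<^sup>2 = (- z + - x - 2 * - a - - \<mu>\<^sub>1 * t)\<^sup>2"
    by (simp_all add: power2_eq_square algebra_simps)
  \<comment> \<open>The branch conditions match exactly: the point \<open>z = a\<close> lies in the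
    closed branch on both sides.\<close>
  have cond: "\<not> x \<ge> a" "- x \<ge> - a" "z \<le> a \<longleftrightarrow> - z \<ge> - a"
    using assms by auto
  show ?thesis
    unfolding density_version_def if_not_P[OF cond(1)] if_P[OF cond(2)] cond(3) refl
      h1 h2 h3 h4 e(1) e(2)[of _ z a] e(2)[of _ x a] g ..
qed

text \<open>Both branch formulas make sense up to \<open>z = a\<close>. There the shifts
  \<open>(0, z + x - 2 * a)\<close> and \<open>(a - z, x - a)\<close> both become
  \<open>(0, x - a)\<close>, so the branches differ only in the prefactor.\<close>

lemma density_version_pieces:
  assumes "\<sigma>\<^sub>1 > 0" "\<sigma>\<^sub>2 > 0" "t > 0" "x \<ge> a"
  obtains U L where "continuous_on {a..} U" "continuous_on {..a} L"
    "\<And>z. z \<ge> a \<Longrightarrow> density_version a \<mu>\<^sub>1 \<mu>\<^sub>2 \<sigma>\<^sub>1 \<sigma>\<^sub>2 t x z = U z"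
    "\<And>z. z < a \<Longrightarrow> density_version a \<mu>\<^sub>1 \<mu>\<^sub>2 \<sigma>\<^sub>1 \<sigma>\<^sub>2 t x z = L z"
    "U a = 2 / \<sigma>\<^sub>2\<^sup>2 *
       crossing_integral (2 * \<mu>\<^sub>1 / \<sigma>\<^sub>1\<^sup>2) (\<mu>\<^sub>1 / \<sigma>\<^sub>1) (\<mu>\<^sub>2 / \<sigma>\<^sub>2) \<sigma>\<^sub>1 \<sigma>\<^sub>2 t 0 (x - a)"
    "L a = 2 / \<sigma>\<^sub>1\<^sup>2 *
       crossing_integral (2 * \<mu>\<^sub>1 / \<sigma>\<^sub>1\<^sup>2) (\<mu>\<^sub>1 / \<sigma>\<^sub>1) (\<mu>\<^sub>2 / \<sigma>\<^sub>2) \<sigma>\<^sub>1 \<sigma>\<^sub>2 t 0 (x - a)"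
proof -
  let ?K = "crossing_integral (2 * \<mu>\<^sub>1 / \<sigma>\<^sub>1\<^sup>2) (\<mu>\<^sub>1 / \<sigma>\<^sub>1) (\<mu>\<^sub>2 / \<sigma>\<^sub>2) \<sigma>\<^sub>1 \<sigma>\<^sub>2 t"
  let ?F = "crossing_integrand (2 * \<mu>\<^sub>1 / \<sigma>\<^sub>1\<^sup>2) (\<mu>\<^sub>1 / \<sigma>\<^sub>1) (\<mu>\<^sub>2 / \<sigma>\<^sub>2) \<sigma>\<^sub>1 \<sigma>\<^sub>2 t"
  define U where "U z = 2 / \<sigma>\<^sub>2\<^sup>2 * (exp (2 * \<mu>\<^sub>2 * (z - a) / \<sigma>\<^sub>2\<^sup>2) * ?K 0 (z + x - 2 * a))
          + 1 / sqrt (2 * pi * t * \<sigma>\<^sub>2\<^sup>2) *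
             (exp (- ((z - x - \<mu>\<^sub>2 * t)\<^sup>2 / (2 * t * \<sigma>\<^sub>2\<^sup>2)))
              - exp (- ((z + x - 2 * a - \<mu>\<^sub>2 * t)\<^sup>2 / (2 * t * \<sigma>\<^sub>2\<^sup>2)) - 2 * \<mu>\<^sub>2 * (x - a) / \<sigma>\<^sub>2\<^sup>2))" for z
  define L where "L z = 2 / \<sigma>\<^sub>1\<^sup>2 * ?K (a - z) (x - a)" for z
  note K = continuous_on_crossing_integral[OF assms(1-3), of "2 * \<mu>\<^sub>1 / \<sigma>\<^sub>1\<^sup>2" "\<mu>\<^sub>1 / \<sigma>\<^sub>1" "\<mu>\<^sub>2 / \<sigma>\<^sub>2"]
  have K_comp: "continuous_on S (\<lambda>z. ?K (f z) (g z))"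
    if "continuous_on S f" "continuous_on S g" "\<And>z. z \<in> S \<Longrightarrow> 0 \<le> f z \<and> 0 \<le> g z" for S f g
    using continuous_on_compose2[OF K continuous_on_Pair[OF that(1,2)]] that(3) by auto
  show ?thesis
  proof (rule that[of U L])
    show "continuous_on {a..} U"
      unfolding U_def using assms by (intro continuous_intros K_comp) auto
    show "continuous_on {..a} L"
      unfolding L_def using assms by (intro continuous_intros K_comp) auto
  next
    fix z assume "z \<ge> a"
    \<comment> \<open>The first exponential depends on neither \<open>b\<close> nor
      \<open>\<tau>\<close>, so it can be pulled out of both integrals.\<close>
    have F: "exp (2 * \<mu>\<^sub>2 * (z - a) / \<sigma>\<^sub>2\<^sup>2) * exp (2 * \<mu>\<^sub>1 * b / \<sigma>\<^sub>1\<^sup>2)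
        * hker (t - \<tau>) (b / \<sigma>\<^sub>1) (\<mu>\<^sub>1 / \<sigma>\<^sub>1) * hker \<tau> ((z + x - 2 * a + b) / \<sigma>\<^sub>2) (\<mu>\<^sub>2 / \<sigma>\<^sub>2)
        = exp (2 * \<mu>\<^sub>2 * (z - a) / \<sigma>\<^sub>2\<^sup>2) * ?F 0 (z + x - 2 * a) b \<tau>" for b \<tau>
      by (simp add: crossing_integrand_def add.commute)
    show "density_version a \<mu>\<^sub>1 \<mu>\<^sub>2 \<sigma>\<^sub>1 \<sigma>\<^sub>2 t x z = U z"
      using \<open>z \<ge> a\<close> \<open>x \<ge> a\<close>
      unfolding density_version_def F U_def set_integral_mult_right crossing_integral_def by simp
  next
    fix z assume "z < a"
    have F: "exp (2 * \<mu>\<^sub>1 * b / \<sigma>\<^sub>1\<^sup>2) * hker (t - \<tau>) ((b - z + a) / \<sigma>\<^sub>1) (\<mu>\<^sub>1 / \<sigma>\<^sub>1)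
        * hker \<tau> ((x - a + b) / \<sigma>\<^sub>2) (\<mu>\<^sub>2 / \<sigma>\<^sub>2) = ?F (a - z) (x - a) b \<tau>" for b \<tau>
      by (simp add: crossing_integrand_def algebra_simps)
    show "density_version a \<mu>\<^sub>1 \<mu>\<^sub>2 \<sigma>\<^sub>1 \<sigma>\<^sub>2 t x z = L z"
      using \<open>z < a\<close> \<open>x \<ge> a\<close>
      unfolding density_version_def F L_def crossing_integral_def by simp
  next
    \<comment> \<open>The two squares differ by \<open>4 * \<mu>\<^sub>2 * t * (x - a)\<close>,
      which is what the extra term in the second exponential compensates; the Gaussian and its image
      therefore cancel at \<open>z = a\<close>.\<close>
    have "(a - x - \<mu>\<^sub>2 * t)\<^sup>2 / (2 * t * \<sigma>\<^sub>2\<^sup>2)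
        = (a + x - 2 * a - \<mu>\<^sub>2 * t)\<^sup>2 / (2 * t * \<sigma>\<^sub>2\<^sup>2) + 2 * \<mu>\<^sub>2 * (x - a) / \<sigma>\<^sub>2\<^sup>2"
      using assms by (simp add: field_simps power2_eq_square)
    then show "U a = 2 / \<sigma>\<^sub>2\<^sup>2 * ?K 0 (x - a)"
      by (simp add: U_def)
  qed (simp add: L_def)
qed

text \<open>The two exponential weights turn the kernels into those with the opposite drift; shifting
  \<open>b\<close> by \<open>d\<close> and reversing time exchanges the roles of the two kernels.\<close>

lemma crossing_integral_swap:
  assumes "\<sigma>\<^sub>1 > 0" "\<sigma>\<^sub>2 > 0"
  shows "(LBINT b:{d<..}. LBINT \<tau>:{0<..<t}. exp (2 * \<mu>\<^sub>1 * b / \<sigma>\<^sub>1\<^sup>2)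
            * hker (t - \<tau>) (b / \<sigma>\<^sub>1) (\<mu>\<^sub>1 / \<sigma>\<^sub>1) * hker \<tau> ((b - d) / \<sigma>\<^sub>2) (\<mu>\<^sub>2 / \<sigma>\<^sub>2))
    = crossing_integral (2 * - \<mu>\<^sub>2 / \<sigma>\<^sub>2\<^sup>2) (- \<mu>\<^sub>2 / \<sigma>\<^sub>2) (- \<mu>\<^sub>1 / \<sigma>\<^sub>1) \<sigma>\<^sub>2 \<sigma>\<^sub>1 t 0 d"
proof -
  have shift: "(LBINT b:{d<..}. f b) = (LBINT b:{0<..}. f (b + d))" for f :: "real \<Rightarrow> real"
    unfolding set_lebesgue_integral_def
    by (subst lborel_integral_real_affine[where c = 1 and t = d]) (auto simp: indicator_def add.commute)
  have rev: "(LBINT \<tau>:{0<..<t}. f \<tau>) = (LBINT \<tau>:{0<..<t}. f (t - \<tau>))" for f :: "real \<Rightarrow> real"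
    unfolding set_lebesgue_integral_def
    by (subst lborel_integral_real_affine[where c = "-1" and t = t])
      (auto simp: indicator_def intro!: Bochner_Integration.integral_cong)
  have eq: "exp (2 * \<mu>\<^sub>1 * (b + d) / \<sigma>\<^sub>1\<^sup>2) * hker (t - (t - \<tau>)) ((b + d) / \<sigma>\<^sub>1) (\<mu>\<^sub>1 / \<sigma>\<^sub>1)
        * hker (t - \<tau>) ((b + d - d) / \<sigma>\<^sub>2) (\<mu>\<^sub>2 / \<sigma>\<^sub>2)
      = crossing_integrand (2 * - \<mu>\<^sub>2 / \<sigma>\<^sub>2\<^sup>2) (- \<mu>\<^sub>2 / \<sigma>\<^sub>2) (- \<mu>\<^sub>1 / \<sigma>\<^sub>1) \<sigma>\<^sub>2 \<sigma>\<^sub>1 t 0 d b \<tau>"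
    if "0 < \<tau>" "\<tau> < t" for b \<tau>
  proof -
    \<comment> \<open>Both sides reduce to the same product without weights, \<open>hker (t -
      \<tau>) (b / \<sigma>\<^sub>2) (\<mu>\<^sub>2 / \<sigma>\<^sub>2) * hker \<tau> ((b + d) /
      \<sigma>\<^sub>1) (- \<mu>\<^sub>1 / \<sigma>\<^sub>1)\<close>.\<close>
    have "exp (2 * \<mu>\<^sub>1 * (b + d) / \<sigma>\<^sub>1\<^sup>2) * hker \<tau> ((b + d) / \<sigma>\<^sub>1) (\<mu>\<^sub>1 / \<sigma>\<^sub>1)
        = hker \<tau> ((b + d) / \<sigma>\<^sub>1) (- \<mu>\<^sub>1 / \<sigma>\<^sub>1)"
      using exp_times_hker[OF that(1), of "\<mu>\<^sub>1 / \<sigma>\<^sub>1" "(b + d) / \<sigma>\<^sub>1"]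
      by (simp add: power2_eq_square mult.assoc)
    moreover have "exp (2 * - \<mu>\<^sub>2 / \<sigma>\<^sub>2\<^sup>2 * b) * hker (t - \<tau>) (b / \<sigma>\<^sub>2) (- \<mu>\<^sub>2 / \<sigma>\<^sub>2)
        = hker (t - \<tau>) (b / \<sigma>\<^sub>2) (\<mu>\<^sub>2 / \<sigma>\<^sub>2)"
      using exp_times_hker[of "t - \<tau>" "- \<mu>\<^sub>2 / \<sigma>\<^sub>2" "b / \<sigma>\<^sub>2"] that
      by (simp add: power2_eq_square mult.assoc)
    ultimately show ?thesis
      by (simp add: crossing_integrand_def)
  qed
  show ?thesis
    unfolding crossing_integral_def shift
    by (subst rev, intro set_lebesgue_integral_cong allI impI eq) auto
qed

section \<open>The jump of the density at \<open>a\<close> and the criterion for continuity\<close>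

theorem corollary4p1:
  fixes M :: "'w measure" and B :: "real \<Rightarrow> 'w \<Rightarrow> real"
    and X :: "real \<Rightarrow> real \<Rightarrow> 'w \<Rightarrow> real"
    and p :: "real \<Rightarrow> real \<Rightarrow> real \<Rightarrow> real"
    and a \<mu>\<^sub>1 \<mu>\<^sub>2 \<sigma>\<^sub>1 \<sigma>\<^sub>2 t x :: real
  assumes "\<sigma>\<^sub>1 > 0" and "\<sigma>\<^sub>2 > 0"
    and "brownian_motion M B"
    and "\<And>y. sde_strong_solution M B (two_valued a \<mu>\<^sub>1 \<mu>\<^sub>2) (two_valued a \<sigma>\<^sub>1 \<sigma>\<^sub>2) y (X y)"
    and "\<And>s y. s > 0 \<Longrightarrow> distributed M lborel (X y s) (\<lambda>z. ennreal (p s y z))"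
    and "\<And>s y z. s > 0 \<Longrightarrow> p s y z = density_version a \<mu>\<^sub>1 \<mu>\<^sub>2 \<sigma>\<^sub>1 \<sigma>\<^sub>2 s y z"
    and "t > 0"
  shows "continuous_on (- {a}) (\<lambda>z. p t x z) \<and>
    (\<exists>pr pl.
       ((\<lambda>z. p t x z) \<longlongrightarrow> pr) (at_right a) \<and>
       ((\<lambda>z. p t x z) \<longlongrightarrow> pl) (at_left a) \<and>
       pr - pl =
         (if x \<ge> a then
            2 * (1 / \<sigma>\<^sub>2\<^sup>2 - 1 / \<sigma>\<^sub>1\<^sup>2) *
              (LBINT b:{0<..}. LBINT \<tau>:{0<..<t}.
                 exp (2 * \<mu>\<^sub>1 * b / \<sigma>\<^sub>1\<^sup>2)
                 * hker (t - \<tau>) (b / \<sigma>\<^sub>1) (\<mu>\<^sub>1 / \<sigma>\<^sub>1)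
                 * hker \<tau> ((x - a + b) / \<sigma>\<^sub>2) (\<mu>\<^sub>2 / \<sigma>\<^sub>2))
          else
            2 * (1 / \<sigma>\<^sub>2\<^sup>2 - 1 / \<sigma>\<^sub>1\<^sup>2) *
              (LBINT b:{..<0}. LBINT \<tau>:{0<..<t}.
                 exp (2 * \<mu>\<^sub>2 * b / \<sigma>\<^sub>2\<^sup>2)
                 * hker (t - \<tau>) (b / \<sigma>\<^sub>2) (\<mu>\<^sub>2 / \<sigma>\<^sub>2)
                 * hker \<tau> ((x - a + b) / \<sigma>\<^sub>1) (\<mu>\<^sub>1 / \<sigma>\<^sub>1))) \<and>
       pr - pl =
         2 * (1 / \<sigma>\<^sub>2\<^sup>2 - 1 / \<sigma>\<^sub>1\<^sup>2) *
           (LBINT b:{max (a - x) 0<..}. LBINT \<tau>:{0<..<t}.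
              exp (2 * \<mu>\<^sub>1 * b / \<sigma>\<^sub>1\<^sup>2)
              * hker (t - \<tau>) (b / \<sigma>\<^sub>1) (\<mu>\<^sub>1 / \<sigma>\<^sub>1)
              * hker \<tau> ((x - a + b) / \<sigma>\<^sub>2) (\<mu>\<^sub>2 / \<sigma>\<^sub>2))) \<and>
    (continuous_on UNIV (\<lambda>z. p t x z) \<longleftrightarrow> \<sigma>\<^sub>1 = \<sigma>\<^sub>2)"
proof -
  have p: "(\<lambda>z. p t x z) = density_version a \<mu>\<^sub>1 \<mu>\<^sub>2 \<sigma>\<^sub>1 \<sigma>\<^sub>2 t x"
    using assms(6,7) by auto
  \<comment> \<open>The common factor of both one-sided limits; for \<open>x < a\<close> it is
    written with the reflected parameters.\<close>
  define K where "K =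
    (if x \<ge> a then crossing_integral (2 * \<mu>\<^sub>1 / \<sigma>\<^sub>1\<^sup>2) (\<mu>\<^sub>1 / \<sigma>\<^sub>1) (\<mu>\<^sub>2 / \<sigma>\<^sub>2) \<sigma>\<^sub>1 \<sigma>\<^sub>2 t 0 (x - a)
     else crossing_integral (2 * - \<mu>\<^sub>2 / \<sigma>\<^sub>2\<^sup>2) (- \<mu>\<^sub>2 / \<sigma>\<^sub>2) (- \<mu>\<^sub>1 / \<sigma>\<^sub>1) \<sigma>\<^sub>2 \<sigma>\<^sub>1 t 0 (a - x))"
  have "K > 0"
    using assms(1,2,7) by (auto simp: K_def intro!: crossing_integral_pos)
  obtain U L where UL: "continuous_on {a..} U" "continuous_on {..a} L"
    "\<And>z. z > a \<Longrightarrow> p t x z = U z" "\<And>z. z < a \<Longrightarrow> p t x z = L z" "p t x a = U a \<or> p t x a = L a"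
    "U a = 2 / \<sigma>\<^sub>2\<^sup>2 * K" "L a = 2 / \<sigma>\<^sub>1\<^sup>2 * K"
  proof (cases "x \<ge> a")
    case True
    obtain U L where "continuous_on {a..} U" "continuous_on {..a} L"
      "\<And>z. z \<ge> a \<Longrightarrow> p t x z = U z" "\<And>z. z < a \<Longrightarrow> p t x z = L z"
      "U a = 2 / \<sigma>\<^sub>2\<^sup>2 * K" "L a = 2 / \<sigma>\<^sub>1\<^sup>2 * K"
      using density_version_pieces[OF assms(1,2,7) True, of \<mu>\<^sub>1 \<mu>\<^sub>2] True
      unfolding fun_cong[OF p] K_def by auto
    then show ?thesis by (intro that[of U L]) auto
  next
    case False
    then have x: "- x \<ge> - a" "x < a" by auto
    have K: "K = crossing_integral (2 * - \<mu>\<^sub>2 / \<sigma>\<^sub>2\<^sup>2) (- \<mu>\<^sub>2 / \<sigma>\<^sub>2) (- \<mu>\<^sub>1 / \<sigma>\<^sub>1) \<sigma>\<^sub>2 \<sigma>\<^sub>1 t 0 (- x - - a)"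
      using False by (simp add: K_def)
    obtain U L where UL: "continuous_on {- a..} U" "continuous_on {..- a} L"
      "\<And>z. z \<ge> - a \<Longrightarrow> density_version (- a) (- \<mu>\<^sub>2) (- \<mu>\<^sub>1) \<sigma>\<^sub>2 \<sigma>\<^sub>1 t (- x) z = U z"
      "\<And>z. z < - a \<Longrightarrow> density_version (- a) (- \<mu>\<^sub>2) (- \<mu>\<^sub>1) \<sigma>\<^sub>2 \<sigma>\<^sub>1 t (- x) z = L z"
      "U (- a) = 2 / \<sigma>\<^sub>1\<^sup>2 * K" "L (- a) = 2 / \<sigma>\<^sub>2\<^sup>2 * K"
      unfolding K using density_version_pieces[OF assms(2,1,7) x(1), of "- \<mu>\<^sub>2" "- \<mu>\<^sub>1"] by blast
    have p_reflect: "p t x z = density_version (- a) (- \<mu>\<^sub>2) (- \<mu>\<^sub>1) \<sigma>\<^sub>2 \<sigma>\<^sub>1 t (- x) (- z)" for z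
      unfolding fun_cong[OF p] by (rule density_version_reflect[OF x(2)])
    \<comment> \<open>Reflection exchanges the sides: the lower branch of the reflected density is
      the branch above \<open>a\<close>, and the value at \<open>a\<close> comes from the branch
      below.\<close>
    have "continuous_on {a..} (\<lambda>z. L (- z))" "continuous_on {..a} (\<lambda>z. U (- z))"
      by (auto intro!: continuous_on_compose2[OF UL(1)] continuous_on_compose2[OF UL(2)] continuous_intros)
    with UL(5,6) show ?thesis by (intro that[of "\<lambda>z. L (- z)" "\<lambda>z. U (- z)"]) (auto simp: p_reflect UL(3,4))
  qed
  note glue = continuous_on_one_sided_glue[OF UL(1-5)]
  have jump: "U a - L a = 2 * (1 / \<sigma>\<^sub>2\<^sup>2 - 1 / \<sigma>\<^sub>1\<^sup>2) * K"
    unfolding UL(6,7) by (simp add: algebra_simps)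
  have K_ge: "K = (LBINT b:{0<..}. LBINT \<tau>:{0<..<t}. exp (2 * \<mu>\<^sub>1 * b / \<sigma>\<^sub>1\<^sup>2)
      * hker (t - \<tau>) (b / \<sigma>\<^sub>1) (\<mu>\<^sub>1 / \<sigma>\<^sub>1) * hker \<tau> ((x - a + b) / \<sigma>\<^sub>2) (\<mu>\<^sub>2 / \<sigma>\<^sub>2))" if "x \<ge> a"
    using that by (simp add: K_def crossing_integral_def crossing_integrand_def algebra_simps)
  have K_less: "K = (LBINT b:{..<0}. LBINT \<tau>:{0<..<t}. exp (2 * \<mu>\<^sub>2 * b / \<sigma>\<^sub>2\<^sup>2)
      * hker (t - \<tau>) (b / \<sigma>\<^sub>2) (\<mu>\<^sub>2 / \<sigma>\<^sub>2) * hker \<tau> ((x - a + b) / \<sigma>\<^sub>1) (\<mu>\<^sub>1 / \<sigma>\<^sub>1))" if "\<not> x \<ge> a"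
  proof -
    have "hker s (- b / \<sigma>\<^sub>2) (\<mu>\<^sub>2 / \<sigma>\<^sub>2) = hker s (b / \<sigma>\<^sub>2) (- \<mu>\<^sub>2 / \<sigma>\<^sub>2)"
      "hker s ((x - a + - b) / \<sigma>\<^sub>1) (\<mu>\<^sub>1 / \<sigma>\<^sub>1) = hker s ((b + (a - x)) / \<sigma>\<^sub>1) (- \<mu>\<^sub>1 / \<sigma>\<^sub>1)" for s b
      using hker_uminus[of s "b / \<sigma>\<^sub>2" "- \<mu>\<^sub>2 / \<sigma>\<^sub>2"] hker_uminus[of s "(b + (a - x)) / \<sigma>\<^sub>1" "- \<mu>\<^sub>1 / \<sigma>\<^sub>1"]
      by (simp_all add: minus_divide_left del: divide_minus_left)
    then show ?thesis
      using that
      by (subst set_integral_reflect)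
        (simp add: K_def crossing_integral_def crossing_integrand_def greaterThan_def)
  qed
  \<comment> \<open>For \<open>x \<ge> a\<close> the lower limit is 0 and this is
    \<open>K_ge\<close>. For \<open>x < a\<close> it is \<open>a - x\<close>, and
    \<open>crossing_integral_swap\<close> with \<open>d = a - x\<close> gives the reflected
    integral.\<close>
  have K_max: "K = (LBINT b:{max (a - x) 0<..}. LBINT \<tau>:{0<..<t}. exp (2 * \<mu>\<^sub>1 * b / \<sigma>\<^sub>1\<^sup>2)
      * hker (t - \<tau>) (b / \<sigma>\<^sub>1) (\<mu>\<^sub>1 / \<sigma>\<^sub>1) * hker \<tau> ((x - a + b) / \<sigma>\<^sub>2) (\<mu>\<^sub>2 / \<sigma>\<^sub>2))"
  proof (cases "x \<ge> a")
    case True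
    then show ?thesis by (simp add: K_ge max_def)
  next
    case False
    then have "max (a - x) 0 = a - x" by simp
    moreover have "x - a + b = b - (a - x)" for b by simp
    ultimately show ?thesis
      using False crossing_integral_swap[OF assms(1,2), of "a - x" t \<mu>\<^sub>1 \<mu>\<^sub>2]
      by (simp only: K_def if_False)
  qed
  \<comment> \<open>Dividing by \<open>K > 0\<close> leaves equality of the squares, and positivity
    of both coefficients removes the sign ambiguity.\<close>
  have "U a = L a \<longleftrightarrow> \<sigma>\<^sub>1 = \<sigma>\<^sub>2"
    using \<open>K > 0\<close> assms(1,2) unfolding UL(6,7) by (auto simp: field_simps power2_eq_iff)
  with glue jump K_ge K_less K_max show ?thesis
    by (intro conjI exI[of _ "U a"] exI[of _ "L a"]) simp_all
qed

end
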